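(* Let $\mathsf{ERS}$ be the category of Esakia root systems with continuous p-morphisms and $\mathsf{ERS}_n$ its full subcategory of those of depth $\le n$. For $Y\in\mathsf{ERS}$ let $Y_n=\{y\in Y\mid d(y)\le n\}$ with the subspace topology and induced order, and for a morphism $f\colon Y\to Z$ let $f_n\colon Y_n\to Z_n$ be its restriction. Then $(-)_n\colon\mathsf{ERS}\to\mathsf{ERS}_n$ is a well-defined functor that is right adjoint to the inclusion $\mathsf{ERS}_n\hookrightarrow\mathsf{ERS}$.
   Context: An Esakia root system is a Priestley space (compact space with a partial order such that $x\not\le y$ gives a clopen upset containing $x$ but not $y$) in which ${\downarrow}V$ is clopen for every clopen $V$ and ${\uparrow}y$ is a chain for every $y$. A p-morphism is a map $f$ with $f[{\uparrow}y]={\uparrow}f(y)$. The depth $d(y)$ of $y$ is the cardinality of ${\uparrow}y$ if finite and $\infty$ otherwise; the depth of $Y$ is the supremum of the depths of its points. *)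

theory Defs
  imports "HOL-Analysis.Abstract_Topology" "HOL-Library.Extended_Nat" "HOL-Library.FuncSet"
begin

section \<open>Categories, functors, adjunctions\<close>

text \<open>\<open>Comp C g f\<close> is the composite of \<open>g\<close> after \<open>f\<close>; it is meaningful only when \<open>Cod C f = Dom C g\<close>.\<close>

record ('o, 'm) cat =
  Obj :: "'o set"
  Arr :: "'m set"
  Dom :: "'m \<Rightarrow> 'o"
  Cod :: "'m \<Rightarrow> 'o"
  Ident :: "'o \<Rightarrow> 'm"
  Comp :: "'m \<Rightarrow> 'm \<Rightarrow> 'm"

definition Hom :: "('o, 'm) cat \<Rightarrow> 'o \<Rightarrow> 'o \<Rightarrow> 'm set" where
  "Hom C X Y = {f \<in> Arr C. Dom C f = X \<and> Cod C f = Y}"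

locale category =
  fixes C :: "('o, 'm) cat"
  assumes Dom_in_Obj: "f \<in> Arr C \<Longrightarrow> Dom C f \<in> Obj C"
    and Cod_in_Obj: "f \<in> Arr C \<Longrightarrow> Cod C f \<in> Obj C"
    and Ident_in_Hom: "X \<in> Obj C \<Longrightarrow> Ident C X \<in> Hom C X X"
    and Comp_in_Hom: "\<lbrakk>f \<in> Hom C X Y; g \<in> Hom C Y Z\<rbrakk> \<Longrightarrow> Comp C g f \<in> Hom C X Z"
    and Comp_Ident_right: "f \<in> Hom C X Y \<Longrightarrow> Comp C f (Ident C X) = f"
    and Comp_Ident_left: "f \<in> Hom C X Y \<Longrightarrow> Comp C (Ident C Y) f = f"
    and Comp_assoc: "\<lbrakk>f \<in> Hom C W X; g \<in> Hom C X Y; h \<in> Hom C Y Z\<rbrakk>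
          \<Longrightarrow> Comp C h (Comp C g f) = Comp C (Comp C h g) f"

definition full_subcategory :: "('o, 'm) cat \<Rightarrow> ('o \<Rightarrow> bool) \<Rightarrow> ('o, 'm) cat" where
  "full_subcategory C P =
     C\<lparr>Obj := {X \<in> Obj C. P X}, Arr := {f \<in> Arr C. P (Dom C f) \<and> P (Cod C f)}\<rparr>"

record ('o, 'm, 'p, 'q) fctr =
  FObj :: "'o \<Rightarrow> 'p"
  FArr :: "'m \<Rightarrow> 'q"

locale is_functor = source: category C + target: category D
  for C :: "('o, 'm) cat" and D :: "('p, 'q) cat" +
  fixes F :: "('o, 'm, 'p, 'q) fctr"
  assumes FObj_in_Obj: "X \<in> Obj C \<Longrightarrow> FObj F X \<in> Obj D"
    and FArr_in_Hom: "f \<in> Hom C X Y \<Longrightarrow> FArr F f \<in> Hom D (FObj F X) (FObj F Y)"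
    and FArr_Ident: "X \<in> Obj C \<Longrightarrow> FArr F (Ident C X) = Ident D (FObj F X)"
    and FArr_Comp: "\<lbrakk>f \<in> Hom C X Y; g \<in> Hom C Y Z\<rbrakk>
          \<Longrightarrow> FArr F (Comp C g f) = Comp D (FArr F g) (FArr F f)"

definition inclusion_functor :: "('o, 'm, 'o, 'm) fctr" where
  "inclusion_functor = \<lparr>FObj = (\<lambda>X. X), FArr = (\<lambda>f. f)\<rparr>"

text \<open>\<open>is_right_adjoint C D F G\<close>: the functor \<open>G\<close> from \<open>D\<close> to \<open>C\<close> is right adjoint to the functor
  \<open>F\<close> from \<open>C\<close> to \<open>D\<close>, i.e. there are bijections
  \<open>Hom D (F X) Y \<rightarrow> Hom C X (G Y)\<close> natural in \<open>X\<close> and \<open>Y\<close>.\<close>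

definition is_right_adjoint ::
  "('o, 'm) cat \<Rightarrow> ('p, 'q) cat \<Rightarrow> ('o, 'm, 'p, 'q) fctr \<Rightarrow> ('p, 'q, 'o, 'm) fctr \<Rightarrow> bool" where
  "is_right_adjoint C D F G \<longleftrightarrow>
     is_functor C D F \<and> is_functor D C G \<and>
     (\<exists>\<phi> :: 'o \<Rightarrow> 'p \<Rightarrow> 'q \<Rightarrow> 'm.
        (\<forall>X \<in> Obj C. \<forall>Y \<in> Obj D.
           bij_betw (\<phi> X Y) (Hom D (FObj F X) Y) (Hom C X (FObj G Y))) \<and>
        (\<forall>X \<in> Obj C. \<forall>X' \<in> Obj C. \<forall>Y \<in> Obj D. \<forall>Y' \<in> Obj D.
           \<forall>h \<in> Hom C X' X. \<forall>k \<in> Hom D Y Y'. \<forall>f \<in> Hom D (FObj F X) Y.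
             \<phi> X' Y' (Comp D k (Comp D f (FArr F h))) =
             Comp C (FArr G k) (Comp C (\<phi> X Y f) h)))"


section \<open>Esakia root systems\<close>

text \<open>The underlying set of an ordered space is the \<open>topspace\<close> of its topology; the order is
  a relation on that set, \<open>(x, y) \<in> ord Y\<close> meaning \<open>x \<le> y\<close>.\<close>

record 'a ospace =
  topo :: "'a topology"
  ord :: "'a rel"

abbreviation points :: "'a ospace \<Rightarrow> 'a set" where
  "points Y \<equiv> topspace (topo Y)"

definition clopen_in :: "'a ospace \<Rightarrow> 'a set \<Rightarrow> bool" where
  "clopen_in Y U \<longleftrightarrow> openin (topo Y) U \<and> closedin (topo Y) U"

definition up :: "'a ospace \<Rightarrow> 'a \<Rightarrow> 'a set" where
  "up Y x = {y \<in> points Y. (x, y) \<in> ord Y}"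

definition down :: "'a ospace \<Rightarrow> 'a set \<Rightarrow> 'a set" where
  "down Y V = {x \<in> points Y. \<exists>v \<in> V. (x, v) \<in> ord Y}"

definition upset_in :: "'a ospace \<Rightarrow> 'a set \<Rightarrow> bool" where
  "upset_in Y U \<longleftrightarrow> U \<subseteq> points Y \<and> (\<forall>x \<in> U. up Y x \<subseteq> U)"

definition priestley_space :: "'a ospace \<Rightarrow> bool" where
  "priestley_space Y \<longleftrightarrow>
     compact_space (topo Y) \<and> partial_order_on (points Y) (ord Y) \<and>
     (\<forall>x \<in> points Y. \<forall>y \<in> points Y. (x, y) \<notin> ord Y \<longrightarrow>
        (\<exists>U. clopen_in Y U \<and> upset_in Y U \<and> x \<in> U \<and> y \<notin> U))"

definition esakia_root_system :: "'a ospace \<Rightarrow> bool" where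
  "esakia_root_system Y \<longleftrightarrow>
     priestley_space Y \<and>
     (\<forall>V. clopen_in Y V \<longrightarrow> clopen_in Y (down Y V)) \<and>
     (\<forall>y \<in> points Y. up Y y \<in> Chains (ord Y))"

definition point_depth :: "'a ospace \<Rightarrow> 'a \<Rightarrow> enat" where
  "point_depth Y y = (if finite (up Y y) then enat (card (up Y y)) else \<infinity>)"

definition space_depth :: "'a ospace \<Rightarrow> enat" where
  "space_depth Y = (SUP y \<in> points Y. point_depth Y y)"


section \<open>The category of Esakia root systems\<close>

text \<open>A morphism carries its source and target. Since HOL functions are total, its underlying map is
  required to be \<open>extensional\<close> (that is, \<open>undefined\<close> outside the source), so that two morphisms
  with the same source and target are equal iff they agree on the points of the source.\<close>

record 'a omap =
  src :: "'a ospace"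
  tgt :: "'a ospace"
  fun_of :: "'a \<Rightarrow> 'a"

definition p_morphism :: "'a ospace \<Rightarrow> 'a ospace \<Rightarrow> ('a \<Rightarrow> 'a) \<Rightarrow> bool" where
  "p_morphism Y Z f \<longleftrightarrow>
     f \<in> points Y \<rightarrow> points Z \<and> (\<forall>y \<in> points Y. f ` up Y y = up Z (f y))"

definition ERS :: "('a ospace, 'a omap) cat" where
  "ERS =
    \<lparr>Obj = {Y. esakia_root_system Y},
     Arr = {f. esakia_root_system (src f) \<and> esakia_root_system (tgt f) \<and>
               fun_of f \<in> extensional (points (src f)) \<and>
               continuous_map (topo (src f)) (topo (tgt f)) (fun_of f) \<and>
               p_morphism (src f) (tgt f) (fun_of f)},
     Dom = src,
     Cod = tgt,
     Ident = (\<lambda>Y. \<lparr>src = Y, tgt = Y, fun_of = (\<lambda>y \<in> points Y. y)\<rparr>),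
     Comp = (\<lambda>g f. \<lparr>src = src f, tgt = tgt g,
                    fun_of = compose (points (src f)) (fun_of g) (fun_of f)\<rparr>)\<rparr>"

definition ERS_depth :: "nat \<Rightarrow> ('a ospace, 'a omap) cat" where
  "ERS_depth n = full_subcategory ERS (\<lambda>Y. space_depth Y \<le> enat n)"

definition layer :: "nat \<Rightarrow> 'a ospace \<Rightarrow> 'a set" where
  "layer n Y = {y \<in> points Y. point_depth Y y \<le> enat n}"

definition trunc_space :: "nat \<Rightarrow> 'a ospace \<Rightarrow> 'a ospace" where
  "trunc_space n Y =
     \<lparr>topo = subtopology (topo Y) (layer n Y), ord = ord Y \<inter> (layer n Y \<times> layer n Y)\<rparr>"

definition trunc_map :: "nat \<Rightarrow> 'a omap \<Rightarrow> 'a omap" where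
  "trunc_map n f =
     \<lparr>src = trunc_space n (src f), tgt = trunc_space n (tgt f),
      fun_of = restrict (fun_of f) (layer n (src f))\<rparr>"

definition trunc_functor :: "nat \<Rightarrow> ('a ospace, 'a omap, 'a ospace, 'a omap) fctr" where
  "trunc_functor n = \<lparr>FObj = trunc_space n, FArr = trunc_map n\<rparr>"

end

theory Submission
  imports Defs
begin

text \<open>The points of depth at least \<open>m\<close> form an open set: if \<open>y < z\<close>, \<open>U\<close> is a clopen upset
  containing \<open>z\<close> but not \<open>y\<close>, and \<open>V\<close> is a clopen neighbourhood of \<open>z\<close> of points of depth at least
  \<open>m\<close>, then \<open>\<down>(V \<inter> U) - U\<close> is a clopen neighbourhood of \<open>y\<close> of points of depth at least \<open>m + 1\<close>;
  since \<open>\<up>y\<close> is a chain, for \<open>m \<ge> 1\<close> every \<open>y\<close> of depth at least \<open>m + 1\<close> arises this way. Hence \<open>Y\<^sub>n\<close> is a closed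
  upset. Being closed, it is compact and its clopen subsets are traces of clopen subsets of \<open>Y\<close>; being
  an upset, it inherits the clopenness of downsets and the depth of its points. P-morphisms do not
  increase depth, so a p-morphism out of a space of depth at most \<open>n\<close> into \<open>Y\<close> lands in \<open>Y\<^sub>n\<close>, and the
  adjunction is corestriction.\<close>

section \<open>Clopen sets in Priestley spaces\<close>

lemma clopen_in_Compl: "clopen_in Y U \<Longrightarrow> clopen_in Y (points Y - U)"
  by (auto simp: clopen_in_def)

lemma clopen_in_Int: "clopen_in Y U \<Longrightarrow> clopen_in Y V \<Longrightarrow> clopen_in Y (U \<inter> V)"
  by (auto simp: clopen_in_def)

lemma clopen_in_Diff: "clopen_in Y U \<Longrightarrow> clopen_in Y V \<Longrightarrow> clopen_in Y (U - V)"
  by (auto simp: clopen_in_def)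

lemma clopen_in_Union: "finite \<F> \<Longrightarrow> (\<And>U. U \<in> \<F> \<Longrightarrow> clopen_in Y U) \<Longrightarrow> clopen_in Y (\<Union>\<F>)"
  unfolding clopen_in_def by (blast intro: openin_Union closedin_Union)

lemma clopen_in_subset_points: "clopen_in Y U \<Longrightarrow> U \<subseteq> points Y"
  by (auto simp: clopen_in_def dest: openin_subset)

text \<open>The clopen sets missing \<open>B\<close> cover \<open>A\<close>, and a finite subcover
  has a clopen union that still misses \<open>B\<close>. It serves both for a single point
  \<open>B\<close> and for a closed set \<open>B\<close>.\<close>

lemma compactin_clopen_cover:
  assumes "compactin (topo Y) A"
    and "\<And>a. a \<in> A \<Longrightarrow> \<exists>W. clopen_in Y W \<and> a \<in> W \<and> W \<inter> B = {}"
  shows "\<exists>W. clopen_in Y W \<and> A \<subseteq> W \<and> W \<inter> B = {}"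
proof -
  let ?U = "{W. clopen_in Y W \<and> W \<inter> B = {}}"
  have "A \<subseteq> \<Union>?U" using assms(2) by blast
  then obtain \<F> where "finite \<F>" "\<F> \<subseteq> ?U" "A \<subseteq> \<Union>\<F>"
    using compactinD[OF assms(1), of ?U] by (auto simp: clopen_in_def)
  then show ?thesis
    by (intro exI[of _ "\<Union>\<F>"]) (auto intro!: clopen_in_Union)
qed

text \<open>By antisymmetry one of the two inequalities fails. The clopen upset given by that
  failure, or its complement, is the required set.\<close>

lemma priestley_points_separated:
  assumes "priestley_space Y" "x \<in> points Y" "y \<in> points Y" "x \<noteq> y"
  shows "\<exists>W. clopen_in Y W \<and> x \<in> W \<and> y \<notin> W"
proof -
  have "antisym (ord Y)"
    using assms(1) by (simp add: priestley_space_def partial_order_on_def)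
  with assms(4) consider "(x, y) \<notin> ord Y" | "(y, x) \<notin> ord Y"
    by (auto dest: antisymD)
  then show ?thesis
  proof cases
    case 1
    then show ?thesis using assms by (auto simp: priestley_space_def)
  next
    case 2
    then obtain U where "clopen_in Y U" "y \<in> U" "x \<notin> U"
      using assms by (auto simp: priestley_space_def)
    then show ?thesis
      using assms(2) by (intro exI[of _ "points Y - U"]) (auto intro: clopen_in_Compl)
  qed
qed

text \<open>Compactness is used twice: first \<open>B\<close> is separated from each point
  \<open>a\<close> of \<open>A\<close>, and complements then give clopen neighbourhoods of the
  points of \<open>A\<close> that miss \<open>B\<close>.\<close>

lemma priestley_closed_separated:
  assumes Y: "priestley_space Y"
    and A: "closedin (topo Y) A" and B: "closedin (topo Y) B" and "A \<inter> B = {}"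
  shows "\<exists>W. clopen_in Y W \<and> A \<subseteq> W \<and> W \<inter> B = {}"
proof (rule compactin_clopen_cover)
  have "compact_space (topo Y)" using Y by (simp add: priestley_space_def)
  then have B': "compactin (topo Y) B" and "compactin (topo Y) A"
    using A B closedin_compact_space by blast+
  then show "compactin (topo Y) A" by blast
  fix a assume a: "a \<in> A"
  have "\<exists>W. clopen_in Y W \<and> B \<subseteq> W \<and> W \<inter> {a} = {}"
  proof (rule compactin_clopen_cover[OF B'])
    fix b assume "b \<in> B"
    then have "b \<in> points Y" "a \<in> points Y" "b \<noteq> a"
      using a assms closedin_subset by fast+
    then show "\<exists>W. clopen_in Y W \<and> b \<in> W \<and> W \<inter> {a} = {}"
      using priestley_points_separated[OF Y] by blast
  qed
  then obtain W where "clopen_in Y W" "B \<subseteq> W" "a \<notin> W" by blast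
  moreover have "a \<in> points Y" using A a closedin_subset by fast
  ultimately show "\<exists>W. clopen_in Y W \<and> a \<in> W \<and> W \<inter> B = {}"
    by (intro exI[of _ "points Y - W"]) (auto intro: clopen_in_Compl)
qed

text \<open>As \<open>S\<close> is closed, \<open>V\<close> and \<open>S - V\<close> are disjoint
  closed sets of the whole space; a clopen set separating them has trace \<open>V\<close> on
  \<open>S\<close>.\<close>

lemma clopen_in_closed_subspace_extends:
  assumes Y: "priestley_space Y" and S: "closedin (topo Y) S"
    and V: "openin (subtopology (topo Y) S) V" "closedin (subtopology (topo Y) S) V"
  shows "\<exists>W. clopen_in Y W \<and> V = W \<inter> S"
proof -
  have "closedin (subtopology (topo Y) S) (S - V)"
    using V(1) closedin_subset[OF S] by (metis closedin_diff closedin_topspace topspace_subtopology_subset)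
  then have "closedin (topo Y) (S - V)" "closedin (topo Y) V"
    using S V(2) closedin_trans_full by blast+
  then obtain W where "clopen_in Y W" "V \<subseteq> W" "W \<inter> (S - V) = {}"
    using priestley_closed_separated[OF Y, of V "S - V"] by blast
  moreover have "V \<subseteq> S" using V(1) openin_subset by fastforce
  ultimately show ?thesis by blast
qed

section \<open>Depth\<close>

text \<open>Treats finite and infinite depth uniformly: a lower bound on depth is proved by
  exhibiting \<open>m\<close> points of the upset.\<close>

lemma enat_le_point_depth_iff:
  "enat m \<le> point_depth Y y \<longleftrightarrow> (\<exists>S \<subseteq> up Y y. finite S \<and> card S = m)"
proof (cases "finite (up Y y)")
  case True
  then show ?thesis
    by (auto simp: point_depth_def card_mono intro: obtain_subset_with_card_n)
next
  case False
  then show ?thesis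
    using infinite_arbitrarily_large[OF False, of m] by (auto simp: point_depth_def)
qed

lemma point_depth_mono:
  "up Y x \<subseteq> up Z z \<Longrightarrow> point_depth Y x \<le> point_depth Z z"
  by (auto simp: point_depth_def card_mono dest: finite_subset)

text \<open>By induction, the new element is compared with the least element of the rest.
  \<open>Chains\<close> compares an element also with itself, which supplies reflexivity.\<close>

lemma finite_chain_has_least:
  assumes "finite S" "S \<noteq> {}" "S \<in> Chains r" "trans r"
  shows "\<exists>m \<in> S. \<forall>x \<in> S. (m, x) \<in> r"
  using assms
proof (induction S rule: finite_ne_induct)
  case (singleton x)
  then show ?case by (auto simp: Chains_def)
next
  case (insert x S)
  then obtain m where m: "m \<in> S" "\<forall>y \<in> S. (m, y) \<in> r" by (auto simp: Chains_def)
  with insert.prems have "(m, x) \<in> r \<or> (x, m) \<in> r" "(x, x) \<in> r" by (auto simp: Chains_def)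
  with m insert.prems(2) show ?case by (auto dest: transD)
qed

context
  fixes Y :: "'a ospace"
  assumes Y: "esakia_root_system Y"
begin

lemma priestley: "priestley_space Y"
  using Y by (simp add: esakia_root_system_def)

lemma ord_refl: "x \<in> points Y \<Longrightarrow> (x, x) \<in> ord Y"
  using priestley
  by (auto simp: priestley_space_def partial_order_on_def preorder_on_def refl_on_def)

lemma ord_trans: "trans (ord Y)"
  using priestley by (auto simp: priestley_space_def partial_order_on_def preorder_on_def)

lemma ord_antisym: "antisym (ord Y)"
  using priestley by (auto simp: priestley_space_def partial_order_on_def preorder_on_def)

lemma up_subset_up: "(x, y) \<in> ord Y \<Longrightarrow> up Y y \<subseteq> up Y x"
  using ord_trans by (auto simp: up_def dest: transD)

text \<open>Induction on \<open>m\<close> with \<open>y\<close> arbitrary, since the induction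
  hypothesis is applied to a point \<open>z\<close> strictly above \<open>y\<close>.\<close>

lemma point_depth_ge_clopen_nhd:
  assumes "y \<in> points Y" "enat m \<le> point_depth Y y"
  shows "\<exists>V. clopen_in Y V \<and> y \<in> V \<and> (\<forall>x \<in> V. enat m \<le> point_depth Y x)"
  using assms
proof (induction m arbitrary: y)
  case 0
  have "enat 0 \<le> point_depth Y x" for x
    unfolding enat_0 by (rule i0_lb)
  with 0 show ?case
    by (intro exI[of _ "points Y"]) (simp add: clopen_in_def)
next
  case (Suc m)
  obtain S where S: "S \<subseteq> up Y y" "finite S" "card S = Suc m"
    using Suc.prems(2) unfolding enat_le_point_depth_iff by blast
  show ?case
  \<comment> \<open>For \<open>m = 0\<close> there may be no point strictly above \<open>y\<close>;
    here the whole space works, because every upset contains its own base point.\<close>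
  proof (cases "m = 0")
    case True
    have "enat (Suc 0) \<le> point_depth Y x" if "x \<in> points Y" for x
      unfolding enat_le_point_depth_iff
      by (rule exI[of _ "{x}"]) (simp add: up_def that ord_refl)
    then show ?thesis
      using True Suc.prems(1) by (intro exI[of _ "points Y"]) (simp add: clopen_in_def)
  next
    case False
    \<comment> \<open>Dropping \<open>y\<close> loses at most one of \<open>Suc m\<close> points.
      The least element \<open>z\<close> of the remaining chain \<open>T\<close> lies strictly above
      \<open>y\<close> and has all of \<open>T\<close> above it.\<close>
    have "m \<le> card (S - {y})" using S by (simp add: card_Diff_singleton_if)
    then obtain T where T: "T \<subseteq> S - {y}" "card T = m" "finite T"
      by (rule obtain_subset_with_card_n)
    have "T \<in> Chains (ord Y)"
    proof -
      have "up Y y \<in> Chains (ord Y)" using Y Suc.prems(1) by (simp add: esakia_root_system_def)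
      with S T show ?thesis unfolding Chains_def by blast
    qed
    moreover have "T \<noteq> {}" using T False by auto
    ultimately obtain z where z: "z \<in> T" "\<forall>x \<in> T. (z, x) \<in> ord Y"
      using finite_chain_has_least T ord_trans by blast
    have zy: "z \<in> points Y" "(y, z) \<in> ord Y" "z \<noteq> y" using z S T by (auto simp: up_def)
    have "T \<subseteq> up Y z" using z S T by (auto simp: up_def)
    then have "enat m \<le> point_depth Y z" using T unfolding enat_le_point_depth_iff by blast
    then obtain V where V: "clopen_in Y V" "z \<in> V" "\<forall>x \<in> V. enat m \<le> point_depth Y x"
      using Suc.IH zy by blast
    have "(z, y) \<notin> ord Y" using zy ord_antisym by (auto dest: antisymD)
    then obtain U where U: "clopen_in Y U" "upset_in Y U" "z \<in> U" "y \<notin> U"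
      using priestley zy Suc.prems(1) unfolding priestley_space_def by blast
    let ?W = "down Y (V \<inter> U) - U"
    have "clopen_in Y ?W"
      using Y U(1) V(1) clopen_in_Diff clopen_in_Int unfolding esakia_root_system_def by metis
    moreover have "y \<in> ?W" using U V zy Suc.prems(1) by (auto simp: down_def)
    moreover have "enat (Suc m) \<le> point_depth Y x" if x: "x \<in> ?W" for x
    proof -
      obtain v where v: "v \<in> V" "v \<in> U" "(x, v) \<in> ord Y" and xY: "x \<in> points Y"
        using x by (auto simp: down_def)
      obtain R where R: "R \<subseteq> up Y v" "finite R" "card R = m"
        using V v unfolding enat_le_point_depth_iff by blast
      \<comment> \<open>The \<open>m\<close> points chosen above \<open>v\<close> stay in the upset
        \<open>U\<close>, whereas \<open>x\<close> is outside it, so \<open>x\<close> counts as one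
        further point.\<close>
      have "up Y v \<subseteq> U" using U v by (auto simp: upset_in_def)
      then have "x \<notin> R" using R x by blast
      moreover have "insert x R \<subseteq> up Y x"
        using R up_subset_up[OF v(3)] ord_refl xY by (auto simp: up_def)
      ultimately show ?thesis
        using R unfolding enat_le_point_depth_iff by (intro exI[of _ "insert x R"]) simp
    qed
    ultimately show ?thesis by blast
  qed
qed

section \<open>Layers and truncated spaces\<close>

lemma layer_subset_points: "layer n Y \<subseteq> points Y"
  by (auto simp: layer_def)

text \<open>Outside the layer the depth is at least \<open>Suc n\<close>, so the clopen
  neighbourhoods of points of such depth show that the complement is open.\<close>

lemma closedin_layer: "closedin (topo Y) (layer n Y)"
proof -
  have "openin (topo Y) (points Y - layer n Y)"
  proof (subst openin_subopen, intro ballI)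
    fix y assume "y \<in> points Y - layer n Y"
    then have "y \<in> points Y" "enat (Suc n) \<le> point_depth Y y"
      by (auto simp: layer_def not_le Suc_ile_eq)
    then obtain V where V: "clopen_in Y V" "y \<in> V" "\<forall>x \<in> V. enat (Suc n) \<le> point_depth Y x"
      using point_depth_ge_clopen_nhd by blast
    have "V \<subseteq> points Y - layer n Y"
      using V clopen_in_subset_points[OF V(1)] by (auto simp: layer_def Suc_ile_eq)
    then show "\<exists>T. openin (topo Y) T \<and> y \<in> T \<and> T \<subseteq> points Y - layer n Y"
      using V by (auto simp: clopen_in_def)
  qed
  then show ?thesis using layer_subset_points by (simp add: closedin_def)
qed

text \<open>Going up in the order shrinks the principal upset, hence cannot increase depth.\<close>

lemma up_subset_layer: "y \<in> layer n Y \<Longrightarrow> up Y y \<subseteq> layer n Y"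
  by (auto simp: layer_def up_def intro: order_trans[OF point_depth_mono[OF up_subset_up]])

lemma points_trunc_space: "points (trunc_space n Y) = layer n Y"
  using layer_subset_points by (auto simp: trunc_space_def)

text \<open>The layer is an upset, so truncation removes nothing above \<open>y\<close>. In
  particular the depth of \<open>y\<close> is the same in both spaces.\<close>

lemma up_trunc_space: "y \<in> layer n Y \<Longrightarrow> up (trunc_space n Y) y = up Y y"
  using up_subset_layer[of y n] layer_subset_points
  by (auto simp: up_def[of "trunc_space n Y"] points_trunc_space)
     (auto simp: trunc_space_def up_def)

lemma space_depth_trunc_space: "space_depth (trunc_space n Y) \<le> enat n"
  unfolding space_depth_def
proof (rule SUP_least)
  fix y assume "y \<in> points (trunc_space n Y)"
  then have "y \<in> layer n Y" by (simp add: points_trunc_space)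
  then show "point_depth (trunc_space n Y) y \<le> enat n"
    by (simp add: point_depth_def[of "trunc_space n Y"] up_trunc_space)
       (simp add: layer_def point_depth_def split: if_splits)
qed

lemma priestley_trunc_space: "priestley_space (trunc_space n Y)"
  unfolding priestley_space_def
proof (intro conjI ballI impI)
  have "compactin (topo Y) (layer n Y)"
    using priestley closedin_layer closedin_compact_space by (auto simp: priestley_space_def)
  then show "compact_space (topo (trunc_space n Y))"
    by (simp add: trunc_space_def compact_space_subtopology)
  show "partial_order_on (points (trunc_space n Y)) (ord (trunc_space n Y))"
    using ord_refl subsetD[OF layer_subset_points] ord_trans ord_antisym
    unfolding points_trunc_space
    by (auto simp: trunc_space_def partial_order_on_def preorder_on_def refl_on_def
        antisym_def intro!: transI dest: transD)
  fix x y assume xy: "x \<in> points (trunc_space n Y)" "y \<in> points (trunc_space n Y)"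
    and "(x, y) \<notin> ord (trunc_space n Y)"
  then have "(x, y) \<notin> ord Y" and l: "x \<in> layer n Y" "y \<in> layer n Y"
    unfolding points_trunc_space by (auto simp: trunc_space_def)
  then obtain U where U: "clopen_in Y U" "upset_in Y U" "x \<in> U" "y \<notin> U"
    using priestley layer_subset_points by (fastforce simp: priestley_space_def)
  \<comment> \<open>The separating clopen upset is the trace of one from \<open>Y\<close>.\<close>
  have "clopen_in (trunc_space n Y) (U \<inter> layer n Y)"
    using U(1) by (auto simp: clopen_in_def trunc_space_def openin_subtopology closedin_subtopology)
  moreover have "upset_in (trunc_space n Y) (U \<inter> layer n Y)"
    using U(2) up_subset_layer
    by (auto simp: upset_in_def points_trunc_space up_trunc_space)
  ultimately show "\<exists>U. clopen_in (trunc_space n Y) U \<and> upset_in (trunc_space n Y) U \<and> x \<in> U \<and> y \<notin> U"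
    using U l by blast
qed

lemma esakia_root_system_trunc_space: "esakia_root_system (trunc_space n Y)"
  unfolding esakia_root_system_def
proof (intro conjI allI impI ballI)
  show "priestley_space (trunc_space n Y)" by (rule priestley_trunc_space)
next
  fix V assume "clopen_in (trunc_space n Y) V"
  then obtain W where W: "clopen_in Y W" "V = W \<inter> layer n Y"
    using clopen_in_closed_subspace_extends[OF priestley closedin_layer]
    by (auto simp: clopen_in_def trunc_space_def)
  \<comment> \<open>Reduces the Esakia condition to that of \<open>Y\<close>. If \<open>x\<close> is
    in the layer and below some \<open>w\<close> in \<open>W\<close>, then \<open>w\<close> is in
    the layer too, hence in \<open>V\<close>.\<close>
  have "down (trunc_space n Y) V = down Y W \<inter> layer n Y"
  proof
    show "down (trunc_space n Y) V \<subseteq> down Y W \<inter> layer n Y"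
      using W by (auto simp: down_def trunc_space_def)
    show "down Y W \<inter> layer n Y \<subseteq> down (trunc_space n Y) V"
    proof
      fix x assume "x \<in> down Y W \<inter> layer n Y"
      then obtain w where x: "x \<in> layer n Y" and w: "w \<in> W" "(x, w) \<in> ord Y"
        by (auto simp: down_def)
      then have "w \<in> layer n Y"
        using up_subset_layer[OF x] clopen_in_subset_points[OF W(1)] by (auto simp: up_def)
      then show "x \<in> down (trunc_space n Y) V"
        using w x W by (auto simp: down_def points_trunc_space) (auto simp: trunc_space_def)
    qed
  qed
  moreover have "clopen_in Y (down Y W)" using Y W by (simp add: esakia_root_system_def)
  ultimately show "clopen_in (trunc_space n Y) (down (trunc_space n Y) V)"
    by (auto simp: clopen_in_def trunc_space_def openin_subtopology closedin_subtopology)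
next
  fix y assume "y \<in> points (trunc_space n Y)"
  then have y: "y \<in> layer n Y" by (simp add: points_trunc_space)
  then have "up Y y \<in> Chains (ord Y)"
    using Y layer_subset_points by (auto simp: esakia_root_system_def)
  then show "up (trunc_space n Y) y \<in> Chains (ord (trunc_space n Y))"
    unfolding up_trunc_space[OF y] using up_subset_layer[OF y]
    by (auto simp: Chains_def trunc_space_def)
qed

end

section \<open>Truncation of morphisms\<close>

text \<open>The upset of \<open>f x\<close> is the image of the upset of \<open>x\<close>, and an
  image of a finite set has at most as many elements.\<close>

lemma point_depth_p_morphism_le:
  assumes "p_morphism X Y f" "x \<in> points X"
  shows "point_depth Y (f x) \<le> point_depth X x"
proof -
  have "up Y (f x) = f ` up X x" using assms by (auto simp: p_morphism_def)
  then show ?thesis by (simp add: point_depth_def card_image_le)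
qed

lemma p_morphism_maps_layer:
  assumes "p_morphism X Y f"
  shows "f \<in> layer n X \<rightarrow> layer n Y"
  using assms point_depth_p_morphism_le[OF assms]
  by (auto simp: layer_def p_morphism_def intro: order_trans)

lemma layer_eq_points:
  assumes "space_depth X \<le> enat n"
  shows "layer n X = points X"
  using assms by (auto simp: layer_def space_depth_def SUP_le_iff)

section \<open>The category of Esakia root systems\<close>

lemma in_Hom_ERS_iff:
  "f \<in> Hom ERS X Y \<longleftrightarrow> src f = X \<and> tgt f = Y \<and> esakia_root_system X \<and> esakia_root_system Y \<and>
     fun_of f \<in> extensional (points X) \<and> continuous_map (topo X) (topo Y) (fun_of f) \<and>
     p_morphism X Y (fun_of f)"
  by (auto simp: Hom_def ERS_def)

lemma Obj_ERS: "X \<in> Obj ERS \<longleftrightarrow> esakia_root_system X"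
  by (simp add: ERS_def)

lemma p_morphism_compose:
  assumes f: "p_morphism X Y f" and g: "p_morphism Y Z g"
  shows "p_morphism X Z (compose (points X) g f)"
  unfolding p_morphism_def
proof (intro conjI ballI)
  show "compose (points X) g f \<in> points X \<rightarrow> points Z"
    using f g by (intro funcset_compose[of _ _ "points Y"]) (simp_all add: p_morphism_def)
  fix x assume x: "x \<in> points X"
  then have "f x \<in> points Y" using f by (auto simp: p_morphism_def)
  have "compose (points X) g f ` up X x = g ` f ` up X x"
    unfolding image_image by (rule image_cong) (auto simp: compose_def up_def)
  also have "f ` up X x = up Y (f x)" using f x by (simp add: p_morphism_def)
  also have "g ` up Y (f x) = up Z (g (f x))"
    using g \<open>f x \<in> points Y\<close> by (simp add: p_morphism_def)
  finally show "compose (points X) g f ` up X x = up Z (compose (points X) g f x)"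
    using x by (simp add: compose_eq)
qed

text \<open>Extensionality of \<open>fun_of\<close> makes the identity laws literal equations, since
  \<open>compose\<close> is \<open>undefined\<close> outside the source.\<close>

lemma category_ERS: "category ERS"
proof
  show "Ident ERS X \<in> Hom ERS X X" if "X \<in> Obj ERS" for X :: "'a ospace"
  proof -
    have "continuous_map (topo X) (topo X) (\<lambda>y \<in> points X. y)"
      by (rule continuous_map_eq[OF continuous_map_id]) simp
    moreover have "p_morphism X X (\<lambda>y \<in> points X. y)"
      by (auto simp: p_morphism_def up_def)
    ultimately show ?thesis using that by (simp add: in_Hom_ERS_iff Obj_ERS) (simp add: ERS_def)
  qed
  show "Comp ERS g f \<in> Hom ERS X Z" if f: "f \<in> Hom ERS X Y" and g: "g \<in> Hom ERS Y Z"
    for f g and X Y Z :: "'a ospace"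
  proof -
    have "continuous_map (topo X) (topo Z) (compose (points X) (fun_of g) (fun_of f))"
    proof (rule continuous_map_eq)
      show "continuous_map (topo X) (topo Z) (fun_of g \<circ> fun_of f)"
        using f g continuous_map_compose unfolding in_Hom_ERS_iff by blast
    qed (simp add: compose_def)
    moreover have "p_morphism X Z (compose (points X) (fun_of g) (fun_of f))"
      using f g p_morphism_compose unfolding in_Hom_ERS_iff by blast
    ultimately show ?thesis
      using f g by (simp add: in_Hom_ERS_iff) (simp add: ERS_def)
  qed
  show "Comp ERS f (Ident ERS X) = f" if "f \<in> Hom ERS X Y" for f and X Y :: "'a ospace"
  proof -
    have "src f = X" "compose (points X) (fun_of f) (\<lambda>x \<in> points X. x) = fun_of f"
      using that compose_Id[of "fun_of f" "points X" "points Y"]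
      unfolding in_Hom_ERS_iff p_morphism_def by blast+
    then show ?thesis by (simp add: ERS_def)
  qed
  show "Comp ERS (Ident ERS Y) f = f" if "f \<in> Hom ERS X Y" for f and X Y :: "'a ospace"
  proof -
    have "src f = X" "tgt f = Y" "compose (points X) (\<lambda>y \<in> points Y. y) (fun_of f) = fun_of f"
      using that Id_compose[of "fun_of f" "points X" "points Y"]
      unfolding in_Hom_ERS_iff p_morphism_def by blast+
    then show ?thesis by (simp add: ERS_def)
  qed
  show "Comp ERS h (Comp ERS g f) = Comp ERS (Comp ERS h g) f"
    if "f \<in> Hom ERS W X" "g \<in> Hom ERS X Y" "h \<in> Hom ERS Y Z" for f g h and W X Y Z :: "'a ospace"
  proof -
    have "src f = W" "src g = X" "fun_of f \<in> points W \<rightarrow> points X"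
      using that unfolding in_Hom_ERS_iff p_morphism_def by blast+
    then show ?thesis by (simp add: ERS_def compose_assoc[of _ _ "points X"])
  qed
qed (auto simp: ERS_def)

section \<open>Full subcategories and their inclusions\<close>

lemma full_subcategory_simps:
  "Obj (full_subcategory C P) = {X \<in> Obj C. P X}"
  "Ident (full_subcategory C P) = Ident C"
  "Comp (full_subcategory C P) = Comp C"
  by (simp_all add: full_subcategory_def)

lemma Hom_full_subcategory:
  "Hom (full_subcategory C P) X Y = (if P X \<and> P Y then Hom C X Y else {})"
  by (auto simp: Hom_def full_subcategory_def)

lemma category_full_subcategory:
  assumes "category C"
  shows "category (full_subcategory C P)"
proof -
  interpret category C by fact
  show ?thesis
  proof
    show "Dom (full_subcategory C P) f \<in> Obj (full_subcategory C P)"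
      "Cod (full_subcategory C P) f \<in> Obj (full_subcategory C P)"
      if "f \<in> Arr (full_subcategory C P)" for f
      using that Dom_in_Obj Cod_in_Obj by (auto simp: full_subcategory_def)
  qed (auto simp: Hom_full_subcategory Ident_in_Hom Comp_in_Hom Comp_Ident_left Comp_Ident_right
      Comp_assoc full_subcategory_simps split: if_splits)
qed

lemma is_functor_inclusion:
  assumes "category C"
  shows "is_functor (full_subcategory C P) C inclusion_functor"
  using category_full_subcategory[OF assms, of P] assms
  by (auto simp: is_functor_def is_functor_axioms_def inclusion_functor_def Hom_full_subcategory
      full_subcategory_simps split: if_splits)

section \<open>The depth-bounded subcategory and the truncation functor\<close>

lemma in_Hom_ERS_depth_iff:
  "f \<in> Hom (ERS_depth n) X Y \<longleftrightarrow>
     f \<in> Hom ERS X Y \<and> space_depth X \<le> enat n \<and> space_depth Y \<le> enat n"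
  by (simp add: ERS_depth_def Hom_full_subcategory)

lemma Obj_ERS_depth: "X \<in> Obj (ERS_depth n) \<longleftrightarrow> esakia_root_system X \<and> space_depth X \<le> enat n"
  by (simp add: ERS_depth_def full_subcategory_simps Obj_ERS)

lemma Comp_ERS_depth: "Comp (ERS_depth n) = Comp ERS"
  by (simp add: ERS_depth_def full_subcategory_simps)

lemma Ident_ERS_depth: "Ident (ERS_depth n) = Ident ERS"
  by (simp add: ERS_depth_def full_subcategory_simps)

lemma trunc_map_in_Hom:
  assumes "f \<in> Hom ERS X Y"
  shows "trunc_map n f \<in> Hom ERS (trunc_space n X) (trunc_space n Y)"
proof -
  have f: "src f = X" "tgt f = Y" "esakia_root_system X" "esakia_root_system Y"
    "continuous_map (topo X) (topo Y) (fun_of f)" "p_morphism X Y (fun_of f)"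
    using assms by (auto simp: in_Hom_ERS_iff)
  note layer = p_morphism_maps_layer[OF f(6), of n]
  let ?g = "restrict (fun_of f) (layer n X)"
  have "continuous_map (subtopology (topo X) (layer n X)) (subtopology (topo Y) (layer n Y)) (fun_of f)"
    using f(5) layer
    by (auto simp: continuous_map_in_subtopology continuous_map_from_subtopology)
  \<comment> \<open>\<open>fun_of f\<close> and \<open>?g\<close> agree on the layer; the
    restriction is what makes the map extensional on the smaller source.\<close>
  then have "continuous_map (topo (trunc_space n X)) (topo (trunc_space n Y)) ?g"
    by (intro continuous_map_eq[of _ _ "fun_of f" ?g]) (simp_all add: trunc_space_def)
  moreover have "p_morphism (trunc_space n X) (trunc_space n Y) ?g"
    unfolding p_morphism_def points_trunc_space[OF f(3)] points_trunc_space[OF f(4)]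
  proof (intro conjI ballI)
    show "?g \<in> layer n X \<rightarrow> layer n Y" using layer by auto
    fix x assume x: "x \<in> layer n X"
    have "?g ` up X x = fun_of f ` up X x"
      using up_subset_layer[OF f(3) x] by (intro image_cong) auto
    also have "\<dots> = up Y (fun_of f x)"
      using f(6) subsetD[OF layer_subset_points[OF f(3)] x] by (simp add: p_morphism_def)
    finally show "?g ` up (trunc_space n X) x = up (trunc_space n Y) (?g x)"
      using x layer by (simp add: up_trunc_space f Pi_iff)
  qed
  ultimately show ?thesis
    using f by (simp add: in_Hom_ERS_iff trunc_map_def points_trunc_space
        esakia_root_system_trunc_space)
qed

lemma is_functor_trunc: "is_functor ERS (ERS_depth n) (trunc_functor n)"
proof (intro is_functor.intro is_functor_axioms.intro)
  show "category ERS" by (rule category_ERS)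
  show "category (ERS_depth n)"
    unfolding ERS_depth_def by (rule category_full_subcategory[OF category_ERS])
  show "FObj (trunc_functor n) X \<in> Obj (ERS_depth n)" if "X \<in> Obj ERS" for X :: "'a ospace"
    using that
    by (simp add: Obj_ERS Obj_ERS_depth trunc_functor_def esakia_root_system_trunc_space
        space_depth_trunc_space)
  show "FArr (trunc_functor n) f \<in> Hom (ERS_depth n) (FObj (trunc_functor n) X) (FObj (trunc_functor n) Y)"
    if "f \<in> Hom ERS X Y" for f and X Y :: "'a ospace"
    using that trunc_map_in_Hom[OF that]
    by (simp add: trunc_functor_def in_Hom_ERS_depth_iff space_depth_trunc_space in_Hom_ERS_iff)
  show "FArr (trunc_functor n) (Ident ERS X) = Ident (ERS_depth n) (FObj (trunc_functor n) X)"
    if "X \<in> Obj ERS" for X :: "'a ospace"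
  proof -
    have X: "esakia_root_system X" using that by (simp add: Obj_ERS)
    then show ?thesis
      using points_trunc_space[OF X, of n] layer_subset_points[OF X, of n]
      by (auto simp: trunc_functor_def Ident_ERS_depth ERS_def trunc_map_def fun_eq_iff)
  qed
  show "FArr (trunc_functor n) (Comp ERS g f)
      = Comp (ERS_depth n) (FArr (trunc_functor n) g) (FArr (trunc_functor n) f)"
    if f: "f \<in> Hom ERS X Y" and g: "g \<in> Hom ERS Y Z" for f g and X Y Z :: "'a ospace"
  proof -
    have X: "esakia_root_system X" and fp: "p_morphism X Y (fun_of f)"
      and st: "src f = X" "src g = Y"
      using f g by (auto simp: in_Hom_ERS_iff)
    \<comment> \<open>Since \<open>fun_of f\<close> maps layer to layer, the restricted
      \<open>fun_of g\<close> is never evaluated at its default value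
      \<open>undefined\<close>.\<close>
    then show ?thesis
      using points_trunc_space[OF X, of n] layer_subset_points[OF X, of n]
        p_morphism_maps_layer[OF fp, of n]
      by (auto simp: trunc_functor_def Comp_ERS_depth ERS_def trunc_map_def compose_def fun_eq_iff)
  qed
qed

section \<open>The adjunction\<close>

text \<open>Only the target field changes. The depth bound makes \<open>X\<close> equal to its own
  layer, so \<open>fun_of f\<close> lands in the layer of \<open>Y\<close>, where upsets agree with
  those of \<open>Y\<close>.\<close>

lemma corestrict_in_Hom:
  assumes f: "f \<in> Hom ERS X Y" and X: "space_depth X \<le> enat n"
  shows "f\<lparr>tgt := trunc_space n Y\<rparr> \<in> Hom (ERS_depth n) X (trunc_space n Y)"
proof -
  have Y: "esakia_root_system Y" and fp: "p_morphism X Y (fun_of f)"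
    using f by (auto simp: in_Hom_ERS_iff)
  have l: "fun_of f \<in> points X \<rightarrow> layer n Y"
    using p_morphism_maps_layer[OF fp, of n] layer_eq_points[OF X] by simp
  have "continuous_map (topo X) (topo (trunc_space n Y)) (fun_of f)"
    using f l by (simp add: trunc_space_def continuous_map_in_subtopology in_Hom_ERS_iff)
  moreover have "p_morphism X (trunc_space n Y) (fun_of f)"
    using fp l by (auto simp: p_morphism_def points_trunc_space[OF Y] up_trunc_space[OF Y] Pi_iff)
  ultimately show ?thesis
    using f X by (simp add: in_Hom_ERS_depth_iff in_Hom_ERS_iff esakia_root_system_trunc_space
        space_depth_trunc_space)
qed

text \<open>Amounts to composing with the inclusion of the layer, which is a p-morphism because the
  layer is an upset.\<close>

lemma extend_codomain_in_Hom:
  assumes g: "g \<in> Hom ERS X (trunc_space n Y)" and Y: "esakia_root_system Y"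
  shows "g\<lparr>tgt := Y\<rparr> \<in> Hom ERS X Y"
proof -
  have gp: "p_morphism X (trunc_space n Y) (fun_of g)"
    using g by (simp add: in_Hom_ERS_iff)
  have "continuous_map (topo X) (topo Y) (fun_of g)"
    using g by (simp add: trunc_space_def continuous_map_in_subtopology in_Hom_ERS_iff)
  moreover have "p_morphism X Y (fun_of g)"
    using gp layer_subset_points[OF Y, of n]
    by (auto simp: p_morphism_def points_trunc_space[OF Y] up_trunc_space[OF Y] Pi_iff)
  ultimately show ?thesis
    using g Y by (simp add: in_Hom_ERS_iff)
qed

lemma bij_betw_corestrict:
  assumes X: "space_depth X \<le> enat n" and Y: "esakia_root_system Y"
  shows "bij_betw (\<lambda>f. f\<lparr>tgt := trunc_space n Y\<rparr>) (Hom ERS X Y) (Hom (ERS_depth n) X (trunc_space n Y))"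
proof (rule bij_betw_byWitness[where f' = "\<lambda>g. g\<lparr>tgt := Y\<rparr>"])
  show "(\<lambda>f. f\<lparr>tgt := trunc_space n Y\<rparr>) ` Hom ERS X Y \<subseteq> Hom (ERS_depth n) X (trunc_space n Y)"
    using corestrict_in_Hom[OF _ X] by auto
  show "(\<lambda>g. g\<lparr>tgt := Y\<rparr>) ` Hom (ERS_depth n) X (trunc_space n Y) \<subseteq> Hom ERS X Y"
    using extend_codomain_in_Hom[OF _ Y] by (auto simp: in_Hom_ERS_depth_iff)
qed (auto simp: in_Hom_ERS_depth_iff in_Hom_ERS_iff)

text \<open>Both sides apply \<open>h\<close>, \<open>f\<close> and \<open>k\<close> in turn. The
  restriction inside \<open>trunc_map n k\<close> is harmless because \<open>f\<close> takes values
  in the layer.\<close>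

lemma corestrict_natural:
  assumes h: "h \<in> Hom ERS X' X" and X: "space_depth X \<le> enat n"
    and f: "f \<in> Hom ERS X Y" and k: "k \<in> Hom ERS Y Y'"
  shows "(Comp ERS k (Comp ERS f h))\<lparr>tgt := trunc_space n Y'\<rparr>
    = Comp ERS (trunc_map n k) (Comp ERS (f\<lparr>tgt := trunc_space n Y\<rparr>) h)"
proof -
  have "p_morphism X Y (fun_of f)" using f by (simp add: in_Hom_ERS_iff)
  from p_morphism_maps_layer[OF this, of n]
  have "fun_of f \<in> points X \<rightarrow> layer n Y" by (simp add: layer_eq_points[OF X])
  then show ?thesis
    using h f k
    by (auto simp: ERS_def Hom_def trunc_map_def compose_def p_morphism_def fun_eq_iff Pi_iff)
qed

theorem theorem2p9:
  fixes n :: nat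
  shows "is_functor (ERS :: ('a ospace, 'a omap) cat) (ERS_depth n) (trunc_functor n) \<and>
         is_right_adjoint (ERS_depth n) (ERS :: ('a ospace, 'a omap) cat)
           inclusion_functor (trunc_functor n)"
proof
  show "is_functor (ERS :: ('a ospace, 'a omap) cat) (ERS_depth n) (trunc_functor n)"
    by (rule is_functor_trunc)
  show "is_right_adjoint (ERS_depth n) (ERS :: ('a ospace, 'a omap) cat)
      inclusion_functor (trunc_functor n)"
    unfolding is_right_adjoint_def
  \<comment> \<open>The hom-set bijection replaces the target field and leaves the underlying
    function unchanged.\<close>
  proof (intro conjI exI[of _ "\<lambda>X Y f. f\<lparr>tgt := trunc_space n Y\<rparr>"] ballI)
    show "is_functor (ERS_depth n) (ERS :: ('a ospace, 'a omap) cat) inclusion_functor"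
      unfolding ERS_depth_def by (rule is_functor_inclusion[OF category_ERS])
    show "is_functor (ERS :: ('a ospace, 'a omap) cat) (ERS_depth n) (trunc_functor n)"
      by (rule is_functor_trunc)
  qed (auto simp: Obj_ERS Obj_ERS_depth inclusion_functor_def trunc_functor_def Comp_ERS_depth
      in_Hom_ERS_depth_iff intro: bij_betw_corestrict corestrict_natural)
qed

end
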